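(* Every $\sigma$-compact abelian locally compact group $A$ embeds as an open subgroup of a compactly generated locally compact group $G$ (that is, $A$ is isomorphic, as a topological group, to an open subgroup of $G$), and $G$ can be chosen to be 3-solvable. If moreover $A$ is totally disconnected (respectively second countable, respectively both totally disconnected and second countable), then $G$ can also be chosen to be totally disconnected (respectively second countable, respectively both).
   Context: Locally compact groups are Hausdorff topological groups whose topology is locally compact. A locally compact group is compactly generated if it is generated, as an abstract group, by some compact subset. A group is $k$-solvable if it is solvable of derived length at most $k$. *)

theory Defs
  imports "HOL-Analysis.Analysis" "HOL-Algebra.Solvable_Groups"
begin

(* Groups follow HOL-Algebra (records with a carrier set) and the topology is a separate
   'a topology whose underlying set is that carrier. *)
locale topological_group = group G
  for G :: "('a, 'm) monoid_scheme" (structure) and T :: "'a topology" +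
  assumes topspace_eq_carrier: "topspace T = carrier G"
    and continuous_mult: "continuous_map (prod_topology T T) T (\<lambda>(x, y). x \<otimes> y)"
    and continuous_inv: "continuous_map T T (\<lambda>x. inv x)"

locale locally_compact_group = topological_group +
  assumes Hausdorff: "Hausdorff_space T"
    and locally_compact: "locally_compact_space T"

definition sigma_compact_space :: "'a topology \<Rightarrow> bool" where
  "sigma_compact_space X \<longleftrightarrow>
     (\<exists>\<C>. countable \<C> \<and> (\<forall>K\<in>\<C>. compactin X K) \<and> \<Union>\<C> = topspace X)"

definition totally_disconnected_space :: "'a topology \<Rightarrow> bool" where
  "totally_disconnected_space X \<longleftrightarrow> (\<forall>S. connectedin X S \<longrightarrow> (\<exists>x. S \<subseteq> {x}))"

definition compactly_generated_group :: "('a, 'm) monoid_scheme \<Rightarrow> 'a topology \<Rightarrow> bool" where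
  "compactly_generated_group G T \<longleftrightarrow> (\<exists>K. compactin T K \<and> generate G K = carrier G)"

(* The derived length is the least n for which the n-th derived subgroup is trivial. *)
definition k_solvable :: "nat \<Rightarrow> ('a, 'm) monoid_scheme \<Rightarrow> bool" where
  "k_solvable k G \<longleftrightarrow> (\<exists>n\<le>k. (derived G ^^ n) (carrier G) = {\<one>\<^bsub>G\<^esub>})"

definition embeds_as_open_subgroup ::
  "('a, 'm) monoid_scheme \<Rightarrow> 'a topology \<Rightarrow> ('b, 'n) monoid_scheme \<Rightarrow> 'b topology \<Rightarrow> bool" where
  "embeds_as_open_subgroup A S G T \<longleftrightarrow>
     (\<exists>H f. subgroup H G \<and> openin T H \<and>
            f \<in> iso A (G\<lparr>carrier := H\<rparr>) \<and> homeomorphic_map S (subtopology T H) f)"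

(* HOL cannot quantify existentially over types, so the ambient group is sought on the type
   'a \<times> nat. This loses no generality: a compactly generated locally compact group is
   sigma-compact, so an open subgroup has countable index in it; choosing an enumeration of the
   cosets embeds the underlying set of any such overgroup of A into 'a \<times> nat. *)
definition compactly_generated_3_solvable_overgroup ::
  "'a monoid \<Rightarrow> 'a topology \<Rightarrow> ('a \<times> nat) monoid \<Rightarrow> ('a \<times> nat) topology \<Rightarrow> bool" where
  "compactly_generated_3_solvable_overgroup A S G T \<longleftrightarrow>
     locally_compact_group G T \<and> compactly_generated_group G T \<and> k_solvable 3 G \<and>
     embeds_as_open_subgroup A S G T"

end

theory Submission
  imports Defs "HOL-Algebra.Free_Abelian_Groups"
begin

text \<open>
  The overgroup is a Heisenberg group over Laurent polynomials, extended by the shift; this is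
  P. Hall's way of placing a countable abelian group at the centre of a finitely generated group.
  Let \<open>R = \<int>[t, 1/t]\<close>, whose additive group is free on the powers of \<open>t\<close>, and let
  \<open>\<phi> : R \<rightarrow> A\<close> be additive. On \<open>A \<times> R \<times> R\<close> the bilinear map \<open>(p, q) \<mapsto> \<phi> (p q)\<close> defines a
  Heisenberg multiplication. Multiplying the first copy of \<open>R\<close> by \<open>1/t\<close> and the second by \<open>t\<close>
  does not change the product \<open>p q\<close>, so it is an automorphism that fixes \<open>A\<close> pointwise. The
  semidirect product \<open>G\<close> with \<open>\<int>\<close> that it defines contains \<open>A\<close> as a central subgroup.

  Why \<open>G\<close> is 3-solvable: \<open>G\<close> modulo the Heisenberg group is \<open>\<int>\<close>, the Heisenberg group modulo \<open>A\<close>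
  is \<open>R \<times> R\<close>, and \<open>A\<close> is abelian.

  Why few generators suffice: conjugating by the shift turns \<open>(1, 0)\<close> and \<open>(0, 1)\<close> in \<open>R \<times> R\<close>
  into \<open>(t\<^sup>m, 0)\<close> and \<open>(0, t\<^sup>m)\<close>, which span both copies of \<open>R\<close>. The commutator
  of \<open>(1, 0)\<close> and \<open>(0, r)\<close> is the central element \<open>\<phi> r\<close>. So the shift, these two
  elements, and any \<open>K \<subseteq> A\<close> such that the translates of \<open>K\<close> by the elements \<open>\<phi> (t\<^sup>m)\<close> cover \<open>A\<close>
  together generate \<open>G\<close> (lemma \<open>generate_G\<close>).

  Why this solves the topological problem: \<open>\<sigma>\<close>-compactness and a compact neighbourhood \<open>K\<close> of the
  identity give countably many translates of \<open>K\<close> covering \<open>A\<close>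
  (\<open>sigma_compact_countable_translates\<close>). As \<open>R\<close> is free, \<open>\<phi>\<close> can take any prescribed
  values on the powers of \<open>t\<close>, in particular the translating elements. Give \<open>G\<close> the product of the
  topology of \<open>A\<close> and the discrete topology on \<open>R \<times> R \<times> \<int>\<close>. Then \<open>G\<close> is locally compact, \<open>A\<close> is
  open in it, and \<open>G\<close> inherits total disconnectedness from \<open>A\<close>. It inherits second countability as
  well, because \<open>R \<times> R \<times> \<int>\<close> is countable.
\<close>

section \<open>Translates of compact sets and products of second countable spaces\<close>

lemma (in topological_group) continuous_map_mult:
  assumes "continuous_map X T f" "continuous_map X T g"
  shows "continuous_map X T (\<lambda>x. f x \<otimes> g x)"
  using continuous_map_compose[OF continuous_map_pairedI[OF assms] continuous_mult]
  by (simp add: o_def)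

lemma (in topological_group) openin_left_translate:
  assumes "openin T U" "g \<in> carrier G"
  shows "openin T {x \<in> carrier G. inv g \<otimes> x \<in> U}"
proof -
  have "continuous_map T T (\<lambda>x. inv g \<otimes> x)"
    using assms(2) by (intro continuous_map_mult) (auto simp: topspace_eq_carrier)
  from openin_continuous_map_preimage[OF this assms(1)] show ?thesis
    by (simp add: topspace_eq_carrier)
qed

text \<open>
  Take an open \<open>U\<close> containing the identity and a compact \<open>K \<supseteq> U\<close>. Each of the countably many compact
  sets that exhaust the group is covered by finitely many translates of \<open>U\<close>.
\<close>

lemma (in locally_compact_group) sigma_compact_countable_translates:
  assumes "sigma_compact_space T"
  obtains K D where "compactin T K" "countable D" "D \<subseteq> carrier G"
    "carrier G \<subseteq> (\<Union>d\<in>D. (\<otimes>) d ` K)"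
proof -
  obtain \<C> where \<C>: "countable \<C>" "\<And>C. C \<in> \<C> \<Longrightarrow> compactin T C" "\<Union>\<C> = carrier G"
    using assms by (auto simp: sigma_compact_space_def topspace_eq_carrier)
  obtain U K where UK: "openin T U" "compactin T K" "\<one> \<in> U" "U \<subseteq> K"
    using locally_compact one_closed unfolding locally_compact_space_def topspace_eq_carrier by blast
  define translate where "translate g = {x \<in> carrier G. inv g \<otimes> x \<in> U}" for g
  have "\<exists>D. finite D \<and> D \<subseteq> carrier G \<and> C \<subseteq> \<Union> (translate ` D)" if C: "C \<in> \<C>" for C
  proof -
    have "C \<subseteq> \<Union> (translate ` carrier G)"
    proof
      fix x assume "x \<in> C"
      then have "x \<in> carrier G" using \<C>(3) C by blast
      then show "x \<in> \<Union> (translate ` carrier G)"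
        using UK(3) by (intro UN_I[of x]) (simp_all add: translate_def)
    qed
    moreover have "\<forall>V \<in> translate ` carrier G. openin T V"
      using openin_left_translate[OF UK(1)] by (auto simp: translate_def)
    ultimately obtain \<F> where \<F>: "finite \<F>" "\<F> \<subseteq> translate ` carrier G" "C \<subseteq> \<Union>\<F>"
      using \<C>(2)[OF C] unfolding compactin_def by meson
    from finite_subset_image[OF \<F>(1,2)] \<F>(3) show ?thesis by blast
  qed
  then obtain D where D: "\<And>C. C \<in> \<C> \<Longrightarrow> finite (D C) \<and> D C \<subseteq> carrier G \<and> C \<subseteq> \<Union> (translate ` D C)"
    by metis
  show thesis
  proof
    show "countable (\<Union> (D ` \<C>))"
      using \<C>(1) D by (auto intro: countable_finite)
    show "\<Union> (D ` \<C>) \<subseteq> carrier G"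
      using D by blast
    show "carrier G \<subseteq> (\<Union>d\<in>\<Union> (D ` \<C>). (\<otimes>) d ` K)"
    proof
      fix x assume x: "x \<in> carrier G"
      then obtain C where "C \<in> \<C>" "x \<in> C" using \<C>(3) by blast
      then obtain d where d: "d \<in> D C" "inv d \<otimes> x \<in> U" "d \<in> carrier G"
        using D by (fastforce simp: translate_def)
      then have "x = d \<otimes> (inv d \<otimes> x)"
        using x by (simp flip: m_assoc)
      then show "x \<in> (\<Union>d\<in>\<Union> (D ` \<C>). (\<otimes>) d ` K)"
        using d UK(4) \<open>C \<in> \<C>\<close> by blast
    qed
  qed (rule UK(2))
qed

lemma second_countable_prod_topology:
  assumes "second_countable X" "second_countable Y"
  shows "second_countable (prod_topology X Y)"
proof -
  obtain \<B> where \<B>: "countable \<B>" "\<forall>V\<in>\<B>. openin X V"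
    "\<forall>U x. openin X U \<and> x \<in> U \<longrightarrow> (\<exists>V\<in>\<B>. x \<in> V \<and> V \<subseteq> U)"
    using assms(1) unfolding second_countable_def by (elim exE conjE)
  obtain \<D> where \<D>: "countable \<D>" "\<forall>V\<in>\<D>. openin Y V"
    "\<forall>U y. openin Y U \<and> y \<in> U \<longrightarrow> (\<exists>V\<in>\<D>. y \<in> V \<and> V \<subseteq> U)"
    using assms(2) unfolding second_countable_def by (elim exE conjE)
  let ?\<B> = "(\<lambda>(U, V). U \<times> V) ` (\<B> \<times> \<D>)"
  show ?thesis
    unfolding second_countable_def
  proof (intro exI[of _ ?\<B>] conjI allI impI ballI)
    show "countable ?\<B>"
      using \<B>(1) \<D>(1) by blast
    show "openin (prod_topology X Y) W" if "W \<in> ?\<B>" for W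
      using that \<B>(2) \<D>(2) by (auto simp: openin_prod_Times_iff)
    show "\<exists>V\<in>?\<B>. z \<in> V \<and> V \<subseteq> W" if "openin (prod_topology X Y) W \<and> z \<in> W" for W z
    proof -
      obtain x y where z: "z = (x, y)" by (cases z)
      obtain U V where UV: "openin X U" "openin Y V" "x \<in> U" "y \<in> V" "U \<times> V \<subseteq> W"
        using \<open>openin (prod_topology X Y) W \<and> z \<in> W\<close> unfolding openin_prod_topology_alt z by blast
      obtain U' V' where "U' \<in> \<B>" "x \<in> U'" "U' \<subseteq> U" "V' \<in> \<D>" "y \<in> V'" "V' \<subseteq> V"
        using \<B>(3) \<D>(3) UV(1-4) by meson
      then show ?thesis
        using UV(5) z by (intro bexI[of _ "U' \<times> V'"]) auto
    qed
  qed
qed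

section \<open>Derived subgroups\<close>

text \<open>
  Describing the commutator \<open>c\<close> of \<open>x\<close> and \<open>y\<close> by the equation \<open>x y = c (y x)\<close> allows coordinates
  of \<open>c\<close> to be read off a multiplication rule, without computing any inverse.
\<close>

lemma (in group) derived_subset:
  assumes "subgroup K G" "H \<subseteq> carrier G"
    and comm: "\<And>x y c. \<lbrakk>x \<in> H; y \<in> H; c \<in> carrier G; x \<otimes> y = c \<otimes> (y \<otimes> x)\<rbrakk> \<Longrightarrow> c \<in> K"
  shows "derived G H \<subseteq> K"
  unfolding derived_def
proof (rule generate_subgroup_incl[OF _ assms(1)], clarsimp)
  fix x y
  assume xy: "x \<in> H" "y \<in> H"
  then have car: "x \<in> carrier G" "y \<in> carrier G" using assms(2) by auto
  have "x \<otimes> y \<otimes> inv x \<otimes> inv y \<otimes> (y \<otimes> x) = x \<otimes> y"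
    using car by (metis (no_types, opaque_lifting) inv_closed inv_mult_group inv_solve_right m_assoc m_closed)
  then show "x \<otimes> y \<otimes> inv x \<otimes> inv y \<in> K"
    using comm[OF xy] car by simp
qed

section \<open>Laurent polynomials\<close>

type_synonym laurent = "int \<Rightarrow>\<^sub>0 int"

abbreviation tpow :: "int \<Rightarrow> laurent" where
  "tpow m \<equiv> Poly_Mapping.single m 1"

lemma tpow_add: "tpow (m + n) = tpow m * tpow n"
  by (simp add: mult_single)

lemma tpow_inverse: "tpow m * tpow (- m) = 1" "tpow (- m) * tpow m = 1"
  by (simp_all add: mult_single)

lemma tpow_cancel: "tpow m * (tpow (- m) * p) = p" "tpow (- m) * (tpow m * p) = p"
  by (simp_all add: tpow_inverse flip: mult.assoc)

text \<open>
  A finitely supported function is determined by its graph over the support, a finite subset of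
  a countable set.
\<close>

instance poly_mapping :: (countable, "{zero, countable}") countable
proof
  define graph :: "('a \<Rightarrow>\<^sub>0 'b) \<Rightarrow> ('a \<times> 'b) set"
    where "graph c = (\<lambda>k. (k, Poly_Mapping.lookup c k)) ` Poly_Mapping.keys c" for c
  have graph_iff: "(k, v) \<in> graph c \<longleftrightarrow> v = Poly_Mapping.lookup c k \<and> v \<noteq> 0" for k v c
    by (auto simp: graph_def in_keys_iff)
  have "inj graph"
  proof (rule injI)
    fix c d :: "'a \<Rightarrow>\<^sub>0 'b"
    assume "graph c = graph d"
    then have "v = Poly_Mapping.lookup c k \<and> v \<noteq> 0 \<longleftrightarrow> v = Poly_Mapping.lookup d k \<and> v \<noteq> 0" for k v
      by (metis graph_iff)
    then show "c = d"
      by (metis poly_mapping_eqI)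
  qed
  moreover have "countable (range graph)"
    by (rule countable_subset[OF _ countable_Collect_finite]) (auto simp: graph_def)
  ultimately show "\<exists>to_nat :: ('a \<Rightarrow>\<^sub>0 'b) \<Rightarrow> nat. inj to_nat"
    by (metis countable_image_inj_on countable_def)
qed

section \<open>The Heisenberg group over Laurent polynomials, extended by the shift\<close>

abbreviation indices :: "nat set" where
  "indices \<equiv> range (to_nat :: laurent \<times> laurent \<times> int \<Rightarrow> nat)"

text \<open>
  The pair \<open>(a, to_nat (p, q, m))\<close> stands for the element of the semidirect product with Heisenberg
  part \<open>(a, p, q)\<close> and shift exponent \<open>m\<close>. The shift by \<open>m\<close> acts on \<open>(p', q')\<close> before
  the Heisenberg product is formed; the cocycle of that product is \<open>(p, q), (p', q') \<mapsto> \<phi> (p q')\<close>.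
\<close>

definition laurent_heisenberg :: "('a, 'm) monoid_scheme \<Rightarrow> (laurent \<Rightarrow> 'a) \<Rightarrow> ('a \<times> nat) monoid"
  where "laurent_heisenberg A \<phi> =
    \<lparr>carrier = carrier A \<times> indices,
     monoid.mult = (\<lambda>(a, i) (b, j). case (from_nat i, from_nat j) of ((p, q, m), (p', q', n)) \<Rightarrow>
       (a \<otimes>\<^bsub>A\<^esub> b \<otimes>\<^bsub>A\<^esub> \<phi> (p * (tpow m * q')),
        to_nat (p + tpow (- m) * p', q + tpow m * q', m + n))),
     one = (\<one>\<^bsub>A\<^esub>, to_nat (0 :: laurent, 0 :: laurent, 0 :: int))\<rparr>"

definition heis :: "'a \<Rightarrow> laurent \<Rightarrow> laurent \<Rightarrow> int \<Rightarrow> 'a \<times> nat" where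
  "heis a p q m = (a, to_nat (p, q, m))"

lemma heis_eq_iff [simp]: "heis a p q m = heis b p' q' n \<longleftrightarrow> a = b \<and> p = p' \<and> q = q' \<and> m = n"
  by (simp add: heis_def)

locale laurent_pairing = comm_group A for A (structure) +
  fixes \<phi> :: "laurent \<Rightarrow> 'a"
  assumes pairing_closed [simp]: "\<phi> r \<in> carrier A"
    and pairing_add: "\<phi> (r + s) = \<phi> r \<otimes> \<phi> s"
begin

abbreviation G where "G \<equiv> laurent_heisenberg A \<phi>"

lemma pairing_zero [simp]: "\<phi> 0 = \<one>"
  using pairing_add[of 0 0] by (metis add_0 l_cancel_one' pairing_closed)

lemma pairing_minus_cancel [simp]: "\<phi> r \<otimes> \<phi> (- r) = \<one>"
  by (simp flip: pairing_add)

lemma heis_in_carrier [simp]: "heis a p q m \<in> carrier G \<longleftrightarrow> a \<in> carrier A"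
  by (simp add: heis_def laurent_heisenberg_def)

lemma carrier_cases:
  assumes "x \<in> carrier G"
  obtains a p q m where "x = heis a p q m" "a \<in> carrier A"
  using assms by (auto simp: heis_def laurent_heisenberg_def)

lemma heis_mult [simp]:
  "heis a p q m \<otimes>\<^bsub>G\<^esub> heis b p' q' n =
   heis (a \<otimes> b \<otimes> \<phi> (p * (tpow m * q'))) (p + tpow (- m) * p') (q + tpow m * q') (m + n)"
  by (simp add: heis_def laurent_heisenberg_def)

lemma heis_one: "\<one>\<^bsub>G\<^esub> = heis \<one> 0 0 0"
  by (simp add: heis_def laurent_heisenberg_def)

text \<open>
  The factor \<open>\<phi> (p q)\<close> compensates the cocycle, which contributes \<open>\<phi> (- p q)\<close>.
\<close>

lemma heis_left_inverse:
  assumes "a \<in> carrier A"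
  shows "heis (inv a \<otimes> \<phi> (p * q)) (- (tpow m * p)) (- (tpow (- m) * q)) (- m) \<otimes>\<^bsub>G\<^esub> heis a p q m =
    \<one>\<^bsub>G\<^esub>"
proof -
  have "tpow m * p * (tpow (- m) * q) = tpow m * (tpow (- m) * (p * q))"
    by (simp only: mult_ac)
  then have cocycle: "- (tpow m * p) * (tpow (- m) * q) = - (p * q)"
    by (simp only: tpow_cancel mult_minus_left)
  have "inv a \<otimes> \<phi> (p * q) \<otimes> a \<otimes> \<phi> (- (p * q)) = \<one>"
    using assms by (simp add: m_ac)
  then show ?thesis
    unfolding heis_mult cocycle heis_one by simp
qed

text \<open>
  Associativity is the cocycle identity for the central extension. It holds because \<open>\<phi>\<close> is additive
  and because the two opposite actions of a power of \<open>t\<close> cancel in the product \<open>p' q''\<close>.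
\<close>

lemma heis_assoc:
  assumes "a \<in> carrier A" "b \<in> carrier A" "c \<in> carrier A"
  shows "heis a p q m \<otimes>\<^bsub>G\<^esub> heis b p' q' n \<otimes>\<^bsub>G\<^esub> heis c p'' q'' k =
    heis a p q m \<otimes>\<^bsub>G\<^esub> (heis b p' q' n \<otimes>\<^bsub>G\<^esub> heis c p'' q'' k)"
proof -
  have "tpow (- m) * p' * (tpow (m + n) * q'') = tpow m * (tpow (- m) * (p' * (tpow n * q'')))"
    unfolding tpow_add by (simp only: mult_ac)
  then have "tpow (- m) * p' * (tpow (m + n) * q'') = p' * (tpow n * q'')"
    by (simp only: tpow_cancel)
  then have "(p + tpow (- m) * p') * (tpow (m + n) * q'') =
      p * (tpow (m + n) * q'') + p' * (tpow n * q'')"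
    by (simp add: distrib_right)
  moreover have "p * (tpow m * (q' + tpow n * q'')) = p * (tpow m * q') + p * (tpow (m + n) * q'')"
    by (simp add: tpow_add algebra_simps)
  moreover have "tpow (- m + - n) = tpow (- m) * tpow (- n)" by (rule tpow_add)
  ultimately show ?thesis
    using assms by (simp add: pairing_add m_ac) (simp add: tpow_add algebra_simps)
qed

lemma group_G: "group G"
proof (rule groupI)
  show "x \<otimes>\<^bsub>G\<^esub> y \<in> carrier G" if "x \<in> carrier G" "y \<in> carrier G" for x y
    using that by (elim carrier_cases) simp
  show "\<one>\<^bsub>G\<^esub> \<in> carrier G" by (simp add: heis_one)
  show "x \<otimes>\<^bsub>G\<^esub> y \<otimes>\<^bsub>G\<^esub> z = x \<otimes>\<^bsub>G\<^esub> (y \<otimes>\<^bsub>G\<^esub> z)"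
    if "x \<in> carrier G" "y \<in> carrier G" "z \<in> carrier G" for x y z
    using that by (elim carrier_cases) (simp add: heis_assoc del: heis_mult)
  show "\<one>\<^bsub>G\<^esub> \<otimes>\<^bsub>G\<^esub> x = x" if "x \<in> carrier G" for x
    using that by (elim carrier_cases) (auto simp: heis_one)
  show "\<exists>y\<in>carrier G. y \<otimes>\<^bsub>G\<^esub> x = \<one>\<^bsub>G\<^esub>" if "x \<in> carrier G" for x
    using that
  proof (rule carrier_cases)
    fix a p q m
    assume "x = heis a p q m" "a \<in> carrier A"
    then show ?thesis
      by (intro bexI[of _ "heis (inv a \<otimes> \<phi> (p * q)) (- (tpow m * p)) (- (tpow (- m) * q)) (- m)"])
        (simp_all add: heis_left_inverse del: heis_mult)
  qed
qed

sublocale G: group G by (rule group_G)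

lemma heis_inv:
  assumes "a \<in> carrier A"
  shows "inv\<^bsub>G\<^esub> (heis a p q m) =
    heis (inv a \<otimes> \<phi> (p * q)) (- (tpow m * p)) (- (tpow (- m) * q)) (- m)"
  using heis_left_inverse[OF assms] assms by (intro G.inv_equality) auto

section \<open>Solvability\<close>

definition nilpotent_part where "nilpotent_part = {heis a p q 0 | a p q. a \<in> carrier A}"

definition central_part where "central_part = {heis a 0 0 0 | a. a \<in> carrier A}"

lemma subgroup_nilpotent_part: "subgroup nilpotent_part G"
proof (rule G.subgroupI)
  show "nilpotent_part \<noteq> {}"
    using one_closed unfolding nilpotent_part_def by blast
qed (auto simp: nilpotent_part_def heis_inv)

lemma subgroup_central_part: "subgroup central_part G"
proof (rule G.subgroupI)
  show "central_part \<noteq> {}"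
    using one_closed unfolding central_part_def by blast
qed (auto simp: central_part_def heis_inv)

lemma derived_carrier: "derived G (carrier G) \<subseteq> nilpotent_part"
proof (rule G.derived_subset[OF subgroup_nilpotent_part])
  show "c \<in> nilpotent_part"
    if "x \<in> carrier G" "y \<in> carrier G" "c \<in> carrier G" "x \<otimes>\<^bsub>G\<^esub> y = c \<otimes>\<^bsub>G\<^esub> (y \<otimes>\<^bsub>G\<^esub> x)" for x y c
    using that by (elim carrier_cases) (auto simp: nilpotent_part_def)
qed simp

lemma derived_nilpotent_part: "derived G nilpotent_part \<subseteq> central_part"
proof (rule G.derived_subset[OF subgroup_central_part])
  show "nilpotent_part \<subseteq> carrier G"
    by (auto simp: nilpotent_part_def)
  show "c \<in> central_part"
    if "x \<in> nilpotent_part" "y \<in> nilpotent_part" "c \<in> carrier G"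
      "x \<otimes>\<^bsub>G\<^esub> y = c \<otimes>\<^bsub>G\<^esub> (y \<otimes>\<^bsub>G\<^esub> x)" for x y c
    using that by (elim carrier_cases) (auto simp: nilpotent_part_def central_part_def algebra_simps)
qed

lemma derived_central_part: "derived G central_part \<subseteq> {\<one>\<^bsub>G\<^esub>}"
proof (rule G.derived_subset[OF G.triv_subgroup])
  show "central_part \<subseteq> carrier G"
    by (auto simp: central_part_def)
  show "c \<in> {\<one>\<^bsub>G\<^esub>}"
    if xy: "x \<in> central_part" "y \<in> central_part" and c: "c \<in> carrier G"
      "x \<otimes>\<^bsub>G\<^esub> y = c \<otimes>\<^bsub>G\<^esub> (y \<otimes>\<^bsub>G\<^esub> x)" for x y c
  proof -
    have "x \<otimes>\<^bsub>G\<^esub> y = y \<otimes>\<^bsub>G\<^esub> x" "y \<otimes>\<^bsub>G\<^esub> x \<in> carrier G"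
      using xy by (auto simp: central_part_def m_comm)
    then show ?thesis
      using c by (metis G.l_cancel_one' G.r_cancel_one' singletonI)
  qed
qed

lemma k_solvable_G: "k_solvable 3 G"
proof -
  have "(derived G ^^ 3) (carrier G) \<subseteq> {\<one>\<^bsub>G\<^esub>}"
  proof -
    have "derived G (derived G (derived G (carrier G))) \<subseteq> {\<one>\<^bsub>G\<^esub>}"
      by (meson G.mono_derived derived_carrier derived_central_part derived_nilpotent_part order_trans)
    then show ?thesis
      by (simp add: eval_nat_numeral)
  qed
  moreover have "\<one>\<^bsub>G\<^esub> \<in> (derived G ^^ 3) (carrier G)"
    by (simp add: eval_nat_numeral derived_def generate.one)
  ultimately show ?thesis
    unfolding k_solvable_def by (metis empty_iff order_refl subset_singletonD)
qed

section \<open>Generators\<close>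

lemma generate_G:
  assumes "K \<subseteq> carrier A" and cover: "carrier A \<subseteq> (\<Union>m. (\<otimes>) (\<phi> (tpow m)) ` K)"
  shows "generate G ((\<lambda>a. heis a 0 0 0) ` K \<union> {heis \<one> 1 0 0, heis \<one> 0 1 0, heis \<one> 0 0 1}) =
    carrier G" (is "generate G ?X = _")
proof -
  let ?\<Gamma> = "generate G ?X"
  have X: "?X \<subseteq> carrier G"
    using assms(1) by auto
  interpret \<Gamma>: subgroup ?\<Gamma> G
    using X by (rule G.generate_is_subgroup)
  have K: "heis a 0 0 0 \<in> ?\<Gamma>" if "a \<in> K" for a
    using that by (intro generate.incl) auto
  have x: "heis \<one> 1 0 0 \<in> ?\<Gamma>" and y: "heis \<one> 0 1 0 \<in> ?\<Gamma>" and t: "heis \<one> 0 0 1 \<in> ?\<Gamma>"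
    by (auto intro: generate.incl)
  have t_nat: "heis \<one> 0 0 (int n) \<in> ?\<Gamma>" for n
  proof (induction n)
    case 0
    then show ?case using \<Gamma>.one_closed by (simp add: heis_one)
  next
    case (Suc n)
    then show ?case using \<Gamma>.m_closed[OF Suc t] by (simp add: add.commute)
  qed
  have t_pow: "heis \<one> 0 0 m \<in> ?\<Gamma>" for m
  proof (cases m rule: int_cases2)
    case (nonpos n)
    then show ?thesis using \<Gamma>.m_inv_closed[OF t_nat[of n]] by (simp add: heis_inv)
  qed (use t_nat in simp)
  \<comment> \<open>The powers of the shift conjugate the two generators of the Heisenberg part to all monomials,
      and these span the Laurent polynomials additively.\<close>
  have x_frag: "heis \<one> (frag_of m) 0 0 \<in> ?\<Gamma>" for m
    using \<Gamma>.m_closed[OF \<Gamma>.m_closed[OF t_pow[of "- m"] x] t_pow[of m]] by simp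
  have y_frag: "heis \<one> 0 (frag_of m) 0 \<in> ?\<Gamma>" for m
    using \<Gamma>.m_closed[OF \<Gamma>.m_closed[OF t_pow[of m] y] t_pow[of "- m"]] by simp
  have x_all: "heis \<one> p 0 0 \<in> ?\<Gamma>" for p
  proof (induction p rule: frag_induction[OF subset_UNIV, case_names zero one diff])
    case (diff a b)
    then show ?case using \<Gamma>.m_closed[OF diff(1) \<Gamma>.m_inv_closed[OF diff(2)]] by (simp add: heis_inv)
  qed (use \<Gamma>.one_closed x_frag in \<open>simp_all add: heis_one\<close>)
  have y_all: "heis \<one> 0 q 0 \<in> ?\<Gamma>" for q
  proof (induction q rule: frag_induction[OF subset_UNIV, case_names zero one diff])
    case (diff a b)
    then show ?case using \<Gamma>.m_closed[OF diff(1) \<Gamma>.m_inv_closed[OF diff(2)]] by (simp add: heis_inv)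
  qed (use \<Gamma>.one_closed y_frag in \<open>simp_all add: heis_one\<close>)
  \<comment> \<open>The commutator of \<open>(1, 0)\<close> and \<open>(0, r)\<close> is the central element \<open>\<phi> r\<close>.\<close>
  have pairing: "heis (\<phi> r) 0 0 0 \<in> ?\<Gamma>" for r
  proof -
    have "heis \<one> 1 0 0 \<otimes>\<^bsub>G\<^esub> heis \<one> 0 r 0 = heis (\<phi> r) 0 0 0 \<otimes>\<^bsub>G\<^esub> (heis \<one> 0 r 0 \<otimes>\<^bsub>G\<^esub> heis \<one> 1 0 0)"
      by simp
    then have "heis (\<phi> r) 0 0 0 = heis \<one> 1 0 0 \<otimes>\<^bsub>G\<^esub> heis \<one> 0 r 0 \<otimes>\<^bsub>G\<^esub>
        inv\<^bsub>G\<^esub> (heis \<one> 0 r 0 \<otimes>\<^bsub>G\<^esub> heis \<one> 1 0 0)"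
      by (subst eq_commute, subst G.inv_solve_right') simp_all
    then show ?thesis
      by (metis \<Gamma>.m_closed \<Gamma>.m_inv_closed x y_all)
  qed
  have central: "heis a 0 0 0 \<in> ?\<Gamma>" if "a \<in> carrier A" for a
  proof -
    from cover that obtain m k where "k \<in> K" "a = \<phi> (tpow m) \<otimes> k" by blast
    then show ?thesis
      using \<Gamma>.m_closed[OF pairing[of "tpow m"] K[of k]] assms(1) by (auto simp: subset_iff)
  qed
  have "heis a p q m \<in> ?\<Gamma>" if "a \<in> carrier A" for a p q m
    using \<Gamma>.m_closed[OF \<Gamma>.m_closed[OF \<Gamma>.m_closed[OF central[OF that] y_all[of q]] x_all[of p]]
        t_pow[of m]]
      that by simp
  then show ?thesis
    using G.generate_incl[OF X] by (blast elim: carrier_cases)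
qed

end

text \<open>
  The powers of \<open>t\<close> form a basis of the additive group of Laurent polynomials.
\<close>

lemma (in comm_group) laurent_pairing_with_prescribed_values:
  assumes "\<And>m. b m \<in> carrier G"
  obtains \<phi> where "laurent_pairing G \<phi>" "\<And>m. \<phi> (tpow m) = b m"
proof -
  obtain h where h: "h \<in> hom (free_Abelian_group UNIV) G" "\<And>m. h (frag_of m) = b m"
    using free_Abelian_group_universal[of b UNIV] assms by auto
  show thesis
  proof
    show "laurent_pairing G h"
    proof
      show "h r \<in> carrier G" for r
        using h(1) by (simp add: hom_def Pi_iff)
      show "h (r + s) = h r \<otimes> h s" for r s
        using h(1) by (simp add: hom_def)
    qed
  qed (rule h(2))
qed

section \<open>The topology\<close>

definition heis_topology :: "'a topology \<Rightarrow> ('a \<times> nat) topology" where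
  "heis_topology S = prod_topology S (discrete_topology indices)"

locale topological_laurent_pairing = laurent_pairing A \<phi> + locally_compact_group A S
  for A (structure) and \<phi> S
begin

abbreviation T where "T \<equiv> heis_topology S"

lemma topspace_T: "topspace T = carrier G"
  by (simp add: heis_topology_def laurent_heisenberg_def topspace_eq_carrier)

text \<open>
  Continuity of the group operations has only one source, the operations of \<open>A\<close>: the cocycle and the
  new index are functions of the discrete coordinates alone, hence continuous.
\<close>

lemma locally_compact_group_G: "locally_compact_group G T"
proof (intro locally_compact_group.intro topological_group.intro topological_group_axioms.intro
    locally_compact_group_axioms.intro)
  let ?D = "discrete_topology indices"
  have fst_T: "continuous_map T S fst" and snd_T: "continuous_map T ?D snd"
    unfolding heis_topology_def by (rule continuous_map_fst continuous_map_snd)+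
  show "group G" by (rule group_G)
  show "topspace T = carrier G" by (rule topspace_T)
  have from_D: "continuous_map ?D X f" if "range f \<subseteq> topspace X" for X f
    using that by auto
  have from_DD: "continuous_map (prod_topology ?D ?D) X f"
    if "f ` (topspace ?D \<times> topspace ?D) \<subseteq> topspace X" for X f
    unfolding prod_topology_discrete_topology[symmetric] using that by (auto simp: image_subset_iff)
  have comp2: "continuous_map (prod_topology T T) X (\<lambda>z. f (snd (fst z), snd (snd z)))"
    if "continuous_map (prod_topology ?D ?D) X f" for X f
    using continuous_map_compose[OF continuous_map_pairedI[OF
        continuous_map_compose[OF continuous_map_fst snd_T]
        continuous_map_compose[OF continuous_map_snd snd_T]] that]
    by (simp add: o_def)
  have comp1: "continuous_map T X (\<lambda>z. f (snd z))" if "continuous_map ?D X f" for X f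
    using continuous_map_compose[OF snd_T that] by (simp add: o_def)
  define cocycle where "cocycle = (\<lambda>(i, j). case (from_nat i, from_nat j) of
    ((p, q :: laurent, m), (p' :: laurent, q', n :: int)) \<Rightarrow> \<phi> (p * (tpow m * q')))"
  define index_mult where "index_mult = (\<lambda>(i, j). case (from_nat i, from_nat j) of ((p, q, m), (p', q', n)) \<Rightarrow>
    to_nat (p + tpow (- m) * p', q + tpow m * q', m + n))"
  have "continuous_map (prod_topology T T) T
      (\<lambda>z. (fst (fst z) \<otimes> fst (snd z) \<otimes> cocycle (snd (fst z), snd (snd z)),
        index_mult (snd (fst z), snd (snd z))))"
    unfolding heis_topology_def[of S]
  proof (rule continuous_map_pairedI, fold heis_topology_def[of S])
    show "continuous_map (prod_topology T T) S
      (\<lambda>z. fst (fst z) \<otimes> fst (snd z) \<otimes> cocycle (snd (fst z), snd (snd z)))"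
      using continuous_map_compose[OF continuous_map_fst fst_T]
        continuous_map_compose[OF continuous_map_snd fst_T]
      by (intro continuous_map_mult comp2 from_DD)
         (auto simp: o_def cocycle_def topspace_eq_carrier split: prod.split)
    show "continuous_map (prod_topology T T) ?D (\<lambda>z. index_mult (snd (fst z), snd (snd z)))"
      by (intro comp2 from_DD) (auto simp: index_mult_def split: prod.split)
  qed
  moreover have "(\<lambda>(x, y). x \<otimes>\<^bsub>G\<^esub> y) =
      (\<lambda>z. (fst (fst z) \<otimes> fst (snd z) \<otimes> cocycle (snd (fst z), snd (snd z)),
        index_mult (snd (fst z), snd (snd z))))"
    by (auto simp: fun_eq_iff laurent_heisenberg_def cocycle_def index_mult_def case_prod_unfold)
  ultimately show "continuous_map (prod_topology T T) T (\<lambda>(x, y). x \<otimes>\<^bsub>G\<^esub> y)"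
    by simp
  define inv_cocycle where "inv_cocycle = (\<lambda>i. case from_nat i of (p :: laurent, q, m :: int) \<Rightarrow> \<phi> (p * q))"
  define index_inv where "index_inv = (\<lambda>i. case from_nat i of (p :: laurent, q :: laurent, m) \<Rightarrow>
    to_nat (- (tpow m * p), - (tpow (- m) * q), - m))"
  have "continuous_map T T (\<lambda>z. (inv (fst z) \<otimes> inv_cocycle (snd z), index_inv (snd z)))"
    unfolding heis_topology_def[of S]
  proof (rule continuous_map_pairedI, fold heis_topology_def[of S])
    show "continuous_map T S (\<lambda>z. inv (fst z) \<otimes> inv_cocycle (snd z))"
      using continuous_map_compose[OF fst_T continuous_inv]
      by (intro continuous_map_mult comp1 from_D)
         (auto simp: o_def inv_cocycle_def topspace_eq_carrier split: prod.split)
    show "continuous_map T ?D (\<lambda>z. index_inv (snd z))"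
      by (intro comp1 from_D) (auto simp: index_inv_def split: prod.split)
  qed
  moreover have "(inv (fst z) \<otimes> inv_cocycle (snd z), index_inv (snd z)) = inv\<^bsub>G\<^esub> z" if "z \<in> topspace T" for z
    using that unfolding topspace_T
    by (elim carrier_cases) (simp add: heis_inv inv_cocycle_def index_inv_def, simp add: heis_def)
  ultimately show "continuous_map T T (\<lambda>x. inv\<^bsub>G\<^esub> x)"
    by (rule continuous_map_eq)
  show "Hausdorff_space T"
    by (simp add: heis_topology_def Hausdorff_space_prod_topology Hausdorff)
  show "locally_compact_space T"
    by (simp add: heis_topology_def locally_compact_space_prod_topology locally_compact
        locally_compact_space_discrete_topology)
qed

lemma continuous_map_central_inclusion: "continuous_map S T (\<lambda>a. heis a 0 0 0)"
  unfolding heis_topology_def heis_def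
  by (intro continuous_map_pairedI) (auto simp: continuous_map_id[unfolded id_def])

lemma embeds_central_part: "embeds_as_open_subgroup A S G T"
  unfolding embeds_as_open_subgroup_def
proof (intro exI conjI)
  show "subgroup central_part G" by (rule subgroup_central_part)
  have "central_part = carrier A \<times> {to_nat (0 :: laurent, 0 :: laurent, 0 :: int)}"
    by (auto simp: central_part_def heis_def)
  then show "openin T central_part"
    by (simp add: heis_topology_def openin_prod_Times_iff flip: topspace_eq_carrier)
  show "(\<lambda>a. heis a 0 0 0) \<in> iso A (G\<lparr>carrier := central_part\<rparr>)"
    by (auto simp: iso_def hom_def bij_betw_def inj_on_def central_part_def)
  have "homeomorphic_maps S (subtopology T central_part) (\<lambda>a. heis a 0 0 0) fst"
    unfolding homeomorphic_maps_def
  proof (intro conjI)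
    show "continuous_map S (subtopology T central_part) (\<lambda>a. heis a 0 0 0)"
      using continuous_map_central_inclusion
      by (auto simp: continuous_map_in_subtopology central_part_def topspace_eq_carrier)
    show "continuous_map (subtopology T central_part) S fst"
      unfolding heis_topology_def by (intro continuous_map_from_subtopology continuous_map_fst)
  qed (auto simp: heis_def central_part_def)
  then show "homeomorphic_map S (subtopology T central_part) (\<lambda>a. heis a 0 0 0)"
    using homeomorphic_map_maps by blast
qed

lemma compactly_generated_G:
  assumes "compactin S K" "carrier A \<subseteq> (\<Union>m. (\<otimes>) (\<phi> (tpow m)) ` K)"
  shows "compactly_generated_group G T"
  unfolding compactly_generated_group_def
proof (intro exI conjI)
  show "compactin T ((\<lambda>a. heis a 0 0 0) ` K \<union> {heis \<one> 1 0 0, heis \<one> 0 1 0, heis \<one> 0 0 1})"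
    by (intro compactin_Un image_compactin[OF assms(1) continuous_map_central_inclusion]
          finite_imp_compactin) (auto simp: topspace_T)
  show "generate G ((\<lambda>a. heis a 0 0 0) ` K \<union> {heis \<one> 1 0 0, heis \<one> 0 1 0, heis \<one> 0 0 1}) =
      carrier G"
    using compactin_subset_topspace[OF assms(1)] assms(2)
    by (intro generate_G) (simp_all add: topspace_eq_carrier)
qed

lemma totally_disconnected_T:
  assumes "totally_disconnected_space S"
  shows "totally_disconnected_space T"
  unfolding totally_disconnected_space_def
proof (intro allI impI)
  fix C assume "connectedin T C"
  then have C: "connectedin (prod_topology S (discrete_topology indices)) C"
    by (simp only: heis_topology_def)
  have "connectedin S (fst ` C)" "connectedin (discrete_topology indices) (snd ` C)"
    using connectedin_continuous_map_image[OF continuous_map_fst C]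
      connectedin_continuous_map_image[OF continuous_map_snd C] .
  then obtain a i where "fst ` C \<subseteq> {a}" "snd ` C \<subseteq> {i}"
    using assms unfolding totally_disconnected_space_def connectedin_discrete_topology by metis
  then have "C \<subseteq> {(a, i)}"
    by (force simp: image_subset_iff)
  then show "\<exists>x. C \<subseteq> {x}" by blast
qed

lemma second_countable_T:
  assumes "second_countable S"
  shows "second_countable T"
  unfolding heis_topology_def
  using assms by (intro second_countable_prod_topology) (simp_all add: second_countable_discrete_topology)

end

section \<open>The embedding theorem\<close>

theorem theorem1p1:
  fixes A :: "'a monoid" and S :: "'a topology"
  assumes "locally_compact_group A S"
    and "comm_group A"
    and "sigma_compact_space S"
  shows "(\<exists>G T. compactly_generated_3_solvable_overgroup A S G T) \<and>
    (totally_disconnected_space S \<longrightarrow>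
       (\<exists>G T. compactly_generated_3_solvable_overgroup A S G T \<and>
              totally_disconnected_space T)) \<and>
    (second_countable S \<longrightarrow>
       (\<exists>G T. compactly_generated_3_solvable_overgroup A S G T \<and>
              second_countable T)) \<and>
    (totally_disconnected_space S \<and> second_countable S \<longrightarrow>
       (\<exists>G T. compactly_generated_3_solvable_overgroup A S G T \<and>
              totally_disconnected_space T \<and> second_countable T))"
proof -
  interpret A: locally_compact_group A S by fact
  interpret comm_group A by fact
  obtain K D where K: "compactin S K" and D: "countable D" "D \<subseteq> carrier A"
    and cover: "carrier A \<subseteq> (\<Union>d\<in>D. (\<otimes>\<^bsub>A\<^esub>) d ` K)"
    using A.sigma_compact_countable_translates[OF assms(3)] .
  have "D \<noteq> {}"
    using cover A.one_closed by auto
  \<comment> \<open>Exponents of \<open>t\<close> range over the integers, and \<open>nat\<close> maps these onto the index set of the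
      enumeration of \<open>D\<close>.\<close>
  define b where "b m = from_nat_into D (nat m)" for m
  have "range b = D"
  proof -
    have "range (from_nat_into D) = D"
      using \<open>D \<noteq> {}\<close> D(1) by (rule range_from_nat_into)
    moreover have "range nat = UNIV"
      by (metis nat_int surjI)
    ultimately show ?thesis
      unfolding b_def by (metis image_image)
  qed
  then obtain \<phi> where "laurent_pairing A \<phi>" and \<phi>: "\<And>m. \<phi> (tpow m) = b m"
    using laurent_pairing_with_prescribed_values[of b] D(2) by blast
  interpret topological_laurent_pairing A \<phi> S
    using \<open>laurent_pairing A \<phi>\<close> assms(1) by (rule topological_laurent_pairing.intro)
  have "compactly_generated_group G T"
    using cover K by (intro compactly_generated_G[of K]) (simp_all add: \<phi> flip: \<open>range b = D\<close>)
  then have "compactly_generated_3_solvable_overgroup A S G T"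
    unfolding compactly_generated_3_solvable_overgroup_def
    using locally_compact_group_G k_solvable_G embeds_central_part by blast
  then show ?thesis
    using totally_disconnected_T second_countable_T by blast
qed

end
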